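(* Let $n$ be an even natural number. Then there is a partition of $\mathbb{F}_3^n$ into maximal $2$-caps.
   Context: $\mathbb{F}_3^n$ denotes $n$-dimensional affine space over the field with three elements. A $k$-dimensional flat is a $k$-dimensional affine subspace. A subset $C \subseteq \mathbb{F}_3^n$ is a $2$-cap if no three points of $C$ lie on a line ($1$-dimensional flat) and no four points of $C$ lie on a $2$-dimensional flat (equivalently, every subset of $C$ of size at most $4$ is affinely independent). A $2$-cap is maximal if it has the largest possible cardinality among all $2$-caps in $\mathbb{F}_3^n$. *)

theory Defs
  imports Complex_Main "HOL-Library.Cardinality" "HOL-Library.Function_Algebras" "HOL-Library.Disjoint_Sets"
begin

definition coord_scale :: "'f::field \<Rightarrow> (nat \<Rightarrow> 'f) \<Rightarrow> (nat \<Rightarrow> 'f)" where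
  "coord_scale c v = (\<lambda>i. c * v i)"

global_interpretation coord: vector_space "coord_scale :: 'f::field \<Rightarrow> (nat \<Rightarrow> 'f) \<Rightarrow> (nat \<Rightarrow> 'f)"
  by unfold_locales (simp_all add: coord_scale_def fun_eq_iff algebra_simps)

text \<open>The coordinates of a point of \<open>F^n\<close> are its values at \<open>0, \<dots>, n - 1\<close>; the remaining
  values are set to zero, so that each point has a unique representative and \<open>F^n\<close> is a
  linear subspace of the sequence space. For \<open>n = 0\<close> it is a single point.\<close>

definition coord_space :: "nat \<Rightarrow> (nat \<Rightarrow> 'f::field) set" where
  "coord_space n = {v. \<forall>i\<ge>n. v i = 0}"

definition flat :: "nat \<Rightarrow> nat \<Rightarrow> (nat \<Rightarrow> 'f::field) set \<Rightarrow> bool" where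
  "flat n k A \<longleftrightarrow>
     (\<exists>p S. p \<in> coord_space n \<and> S \<subseteq> coord_space n \<and>
            coord.subspace S \<and> coord.dim S = k \<and> A = (\<lambda>s. p + s) ` S)"

definition two_cap :: "nat \<Rightarrow> (nat \<Rightarrow> 'f::field) set \<Rightarrow> bool" where
  "two_cap n C \<longleftrightarrow>
     C \<subseteq> coord_space n \<and>
     (\<forall>X\<subseteq>C. card X = 3 \<longrightarrow> \<not> (\<exists>A. flat n 1 A \<and> X \<subseteq> A)) \<and>
     (\<forall>X\<subseteq>C. card X = 4 \<longrightarrow> \<not> (\<exists>A. flat n 2 A \<and> X \<subseteq> A))"

text \<open>Maximality refers to cardinality, not inclusion. Over a finite field all subsets of \<open>F^n\<close>
  are finite, so \<open>card\<close> is the genuine cardinality.\<close>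

definition maximal_two_cap :: "nat \<Rightarrow> (nat \<Rightarrow> 'f::field) set \<Rightarrow> bool" where
  "maximal_two_cap n C \<longleftrightarrow> two_cap n C \<and> (\<forall>D :: (nat \<Rightarrow> 'f) set. two_cap n D \<longrightarrow> card D \<le> card C)"

end

theory Submission
  imports Defs "HOL-Algebra.Algebraic_Closure_Type" "HOL-Number_Theory.Residues" "HOL-Library.Product_Plus"
begin

text \<open>Over the field with three elements a 2-cap is the same thing as a Sidon set, so counting
  differences bounds the size of a 2-cap in \<open>F\<^sup>n\<close>, \<open>n = 2m\<close>, by \<open>q = 3\<^sup>m\<close>. Identify \<open>F\<^sup>n\<close> additively
  with \<open>K \<times> K\<close> for the field \<open>K\<close> with \<open>q\<close> elements. The parabolas \<open>y = x\<^sup>2 + k\<close>, \<open>k \<in> K\<close>, partition the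
  plane, have \<open>q\<close> points each, and are Sidon: \<open>x + y = z + w\<close> and \<open>x\<^sup>2 + y\<^sup>2 = z\<^sup>2 + w\<^sup>2\<close> give
  \<open>2 (x - z) (x - w) = 0\<close>.\<close>

subsection \<open>Counting points\<close>

lemma card_coord_space: "card (coord_space n :: (nat \<Rightarrow> 'f::field) set) = CARD('f) ^ n"
proof (induction n)
  case 0
  have "(coord_space 0 :: (nat \<Rightarrow> 'f) set) = {0}"
    by (auto simp: coord_space_def fun_eq_iff)
  then show ?case by simp
next
  case (Suc n)
  let ?h = "\<lambda>(v, c). v(n := c) :: nat \<Rightarrow> 'f"
  have inj: "inj_on ?h (coord_space n \<times> UNIV)"
  proof (rule inj_onI, clarify)
    fix v w :: "nat \<Rightarrow> 'f" and c d
    assume v: "v \<in> coord_space n" and w: "w \<in> coord_space n" and eq: "v(n := c) = w(n := d)"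
    have "v i = w i" for i
      using fun_cong[OF eq, of i] v w by (cases "i = n") (auto simp: coord_space_def)
    then show "v = w \<and> c = d" using fun_cong[OF eq, of n] by auto
  qed
  have "coord_space (Suc n) = ?h ` (coord_space n \<times> UNIV)"
  proof (intro equalityI subsetI)
    fix v :: "nat \<Rightarrow> 'f" assume "v \<in> coord_space (Suc n)"
    then have "v(n := 0) \<in> coord_space n" by (auto simp: coord_space_def)
    then show "v \<in> ?h ` (coord_space n \<times> UNIV)"
      by (intro image_eqI[of _ _ "(v(n := 0), v n)"]) auto
  qed (auto simp: coord_space_def)
  then show ?case
    by (simp add: card_image[OF inj] card_cartesian_product Suc)
qed

text \<open>Coordinates with respect to a finite basis. Only additivity of \<open>L\<close> is
  recorded, because the Sidon property involves nothing but sums; the dimension \<open>k\<close> is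
  left open and is found later by counting.\<close>

lemma (in vector_space) finite_subspace_coord_iso:
  assumes S: "subspace S" "finite S"
  obtains k L where "bij_betw L (coord_space k :: (nat \<Rightarrow> 'a) set) S" "\<And>u v. L (u + v) = L u + L v"
proof -
  obtain B where B: "B \<subseteq> S" "independent B" "S \<subseteq> span B"
    using maximal_independent_subset by blast
  have finB: "finite B" using B S finite_subset by blast
  obtain b where b: "bij_betw b {..<card B} B"
    using ex_bij_betw_nat_finite[OF finB] by (auto simp: atLeast0LessThan)
  have spanB: "span B = S"
    using B S span_minimal by blast
  define L where "L v = (\<Sum>i<card B. scale (v i) (b i))" for v
  have add: "L (u + v) = L u + L v" for u v
    by (simp add: L_def scale_left_distrib sum.distrib)
  have "inj_on L (coord_space (card B))"
  proof (rule inj_onI)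
    fix u v assume u: "u \<in> coord_space (card B)" and v: "v \<in> coord_space (card B)" and eq: "L u = L v"
    \<comment> \<open>Independence speaks of coefficient functions on \<open>B\<close>, whereas
      \<open>u\<close> and \<open>v\<close> are indexed by numbers; \<open>?g\<close> sends a basis
      vector back to its index.\<close>
    let ?g = "the_inv_into {..<card B} b"
    have "(\<Sum>x\<in>B. scale (u (?g x) - v (?g x)) x) = (\<Sum>i<card B. scale (u i - v i) (b i))"
      by (rule sum.reindex_bij_betw[OF b, symmetric, THEN trans], rule sum.cong)
         (use b in \<open>auto simp: the_inv_into_f_f bij_betw_def\<close>)
    also have "\<dots> = 0"
      using eq by (simp add: L_def scale_left_diff_distrib sum_subtractf)
    finally have z: "u (?g x) - v (?g x) = 0" if "x \<in> B" for x
      using independentD[OF B(2) finB subset_refl, of "\<lambda>x. u (?g x) - v (?g x)"] that by blast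
    show "u = v"
    proof
      fix i show "u i = v i"
      proof (cases "i < card B")
        case True
        then have "b i \<in> B" "?g (b i) = i"
          using b by (auto simp: bij_betw_def the_inv_into_f_f)
        then show ?thesis using z[of "b i"] by simp
      qed (use u v in \<open>auto simp: coord_space_def\<close>)
    qed
  qed
  moreover have "L ` coord_space (card B) = S"
  proof (intro equalityI subsetI)
    fix x assume "x \<in> L ` coord_space (card B)"
    then show "x \<in> S"
      using b by (force intro: span_sum span_scale span_base simp: L_def bij_betw_def simp flip: spanB)
  next
    fix x assume "x \<in> S"
    then obtain u where u: "x = (\<Sum>y\<in>B. scale (u y) y)"
      using spanB span_finite[OF finB] by auto
    define v where "v i = (if i < card B then u (b i) else 0)" for i
    have "x = L v"
      unfolding u L_def v_def
      by (rule sum.reindex_bij_betw[OF b, symmetric, THEN trans]) (rule sum.cong, auto)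
    moreover have "v \<in> coord_space (card B)" by (simp add: coord_space_def v_def)
    ultimately show "x \<in> L ` coord_space (card B)" by blast
  qed
  ultimately show ?thesis
    using that add unfolding bij_betw_def by blast
qed

subsection \<open>The field with $3^m$ elements\<close>

text \<open>Over an algebraically closed field \<open>p\<close> splits into linear factors, and a
  repeated factor would make its root a root of \<open>pderiv p\<close> as well. So the multiset of
  roots is a set.\<close>

lemma card_roots_coprime_pderiv:
  fixes p :: "'a::alg_closed_field poly"
  assumes "p \<noteq> 0" and sep: "\<And>x. poly p x = 0 \<Longrightarrow> poly (pderiv p) x \<noteq> 0"
  shows "card {x. poly p x = 0} = degree p"
proof -
  obtain A where A: "size A = degree p" "p = smult (lead_coeff p) (\<Prod>x\<in>#A. [:-x, 1:])"
    using alg_closed_imp_factorization[OF \<open>p \<noteq> 0\<close>] by blast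
  have "poly p x = 0 \<longleftrightarrow> x \<in># A" for x
    by (subst A(2)) (use \<open>p \<noteq> 0\<close> in \<open>auto simp: poly_prod_mset prod_mset_zero_iff\<close>)
  then have roots: "{x. poly p x = 0} = set_mset A" by auto
  have "count A x = 1" if "x \<in># A" for x
  proof (rule ccontr)
    assume "count A x \<noteq> 1"
    moreover have "count A x > 0" using that by simp
    ultimately have "replicate_mset 2 x \<subseteq># A"
      unfolding count_le_replicate_mset_subset_eq[symmetric] by linarith
    then have "A = replicate_mset 2 x + (A - replicate_mset 2 x)"
      by simp
    then obtain A' where A': "A = add_mset x (add_mset x A')"
      by (simp add: numeral_2_eq_2)
    have "p = [:-x, 1:] * ([:-x, 1:] * smult (lead_coeff p) (\<Prod>x\<in>#A'. [:-x, 1:]))"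
      by (subst A(2)) (simp only: A' image_mset_add_mset prod_mset.add_mset mult_smult_right)
    then obtain r where "p = [:-x, 1:] * ([:-x, 1:] * r)" by blast
    then have "poly p x = 0" "poly (pderiv p) x = 0"
      by (simp_all only: pderiv_mult poly_mult poly_add) simp_all
    then show False using sep by blast
  qed
  then have "size A = card (set_mset A)"
    by (simp add: size_multiset_overloaded_eq)
  then show ?thesis using roots A by simp
qed

lemma CHAR_eq_3:
  assumes "CARD('f::field) = 3"
  shows "CHAR('f) = 3"
proof -
  have "CHAR('f) dvd 3" using CHAR_dvd_CARD[where ?'a='f] assms by simp
  moreover have "prime (3 :: nat)" by simp
  ultimately have "CHAR('f) = 1 \<or> CHAR('f) = 3"
    unfolding prime_nat_iff by metis
  then show ?thesis using CHAR_not_1'[where ?'a='f] by simp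
qed

lemma three_eq_0:
  assumes "CARD('f::field) = 3"
  shows "x + x + x = (0 :: 'f)"
proof -
  have "of_nat 3 = (0 :: 'f)"
    using CHAR_eq_3[OF assms] of_nat_CHAR[where ?'a='f] by simp
  then have "x * (1 + 1 + 1) = 0" by simp
  then show ?thesis by (simp only: distrib_left mult_1_right)
qed

lemma three_vec_eq_0:
  assumes "CARD('f::field) = 3"
  shows "x + x + x = (0 :: nat \<Rightarrow> 'f)"
  using three_eq_0[OF assms] by (simp add: fun_eq_iff)

text \<open>Since 1 + 1 is nonzero in characteristic 3, the elements 0, 1 and -1 are distinct and
  fill the field. This turns questions about scalars into finite case distinctions.\<close>

lemma field_3_cases:
  assumes "CARD('f::field) = 3"
  shows "c = 0 \<or> c = 1 \<or> c = (- 1 :: 'f)"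
proof -
  have "(1 :: 'f) \<noteq> - 1"
  proof
    assume "(1 :: 'f) = - 1"
    then have "1 + 1 = (0 :: 'f)" by (metis add.right_inverse)
    with three_eq_0[OF assms, of 1] show False by (simp only: add_0_left one_neq_zero)
  qed
  then have "card {0, 1, - 1 :: 'f} = CARD('f)" using assms by simp
  moreover have "finite (UNIV :: 'f set)"
    using assms card.infinite by fastforce
  ultimately have "{0, 1, - 1 :: 'f} = UNIV"
    by (intro card_subset_eq) auto
  then show ?thesis by blast
qed

text \<open>Here K is the fixed set of the \<open>m\<close>-th power of the Frobenius map.
  Additivity of Frobenius gives closure under sums, and X^q - X has derivative -1, so its q roots
  are distinct. The last claim makes K a vector space over \<open>'f\<close>.\<close>

lemma subfield_three_pow:
  assumes "CARD('f::field) = 3" "m > 0"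
  defines "S \<equiv> {x :: 'f alg_closure. x ^ (3 ^ m) = x}"
  shows "card S = 3 ^ m"
    and "\<And>x y. x \<in> S \<Longrightarrow> y \<in> S \<Longrightarrow> x + y \<in> S"
    and "\<And>x y. x \<in> S \<Longrightarrow> y \<in> S \<Longrightarrow> x * y \<in> S"
    and "\<And>c. to_ac c \<in> S"
proof -
  let ?q = "3 ^ m :: nat"
  let ?p = "monom 1 ?q - monom 1 1 :: 'f alg_closure poly"
  have CHAR: "CHAR('f alg_closure) = 3"
    using CHAR_eq_3[OF assms(1)] by simp
  have q: "?q > 1" using assms(2) by (intro one_less_power) auto
  have q0: "of_nat ?q = (0 :: 'f alg_closure)"
    unfolding of_nat_eq_0_iff_char_dvd CHAR using assms(2) by simp
  have deg: "degree ?p = ?q"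
    using q degree_add_eq_left[of "- monom 1 1" "monom 1 ?q :: 'f alg_closure poly"]
    by (simp add: degree_monom_eq)
  have "pderiv ?p = - 1"
    unfolding pderiv_diff pderiv_monom q0 by (simp add: monom_0 one_pCons)
  then have "card {x. poly ?p x = 0} = degree ?p"
    using q deg by (intro card_roots_coprime_pderiv) (auto simp del: One_nat_def)
  moreover have "{x. poly ?p x = 0} = S"
    by (auto simp: S_def poly_monom)
  ultimately show "card S = 3 ^ m" unfolding deg by simp
  have frob: "(x + y) ^ ?q = x ^ ?q + y ^ ?q" for x y :: "'f alg_closure"
    using CHAR by (intro freshmans_dream'[where n = m]) auto
  show "x + y \<in> S" "x * y \<in> S" if "x \<in> S" "y \<in> S" for x y
    using that frob by (auto simp: S_def power_mult_distrib)
  show "to_ac c \<in> S" for c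
    \<comment> \<open>The only case of interest is -1, which is fixed because its exponent, a power
      of 3, is odd.\<close>
    using field_3_cases[OF assms(1), of c] by (auto simp: S_def)
qed

text \<open>The plane K x K is a finite vector space over \<open>'f\<close>, so a basis provides
  \<open>E\<close>. The closure properties listed for \<open>S\<close> are the ones the parabolas
  call for, and they hold for \<open>{0}\<close> too, which serves when
  \<open>m = 0\<close>.\<close>

lemma two_coordinates_over_subfield:
  assumes "CARD('f::field) = 3"
  obtains S :: "'f::field alg_closure set" and E :: "(nat \<Rightarrow> 'f) \<Rightarrow> 'f alg_closure \<times> 'f alg_closure"
  where "card S = 3 ^ m" "\<And>x y. x \<in> S \<Longrightarrow> y \<in> S \<Longrightarrow> x + y \<in> S"
    "\<And>x y. x \<in> S \<Longrightarrow> y \<in> S \<Longrightarrow> x * y \<in> S" "\<And>x. x \<in> S \<Longrightarrow> - x \<in> S"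
    "bij_betw E (coord_space (2 * m)) (S \<times> S)" "\<And>u v. E (u + v) = E u + E v"
proof -
  obtain S :: "'f alg_closure set" where S: "card S = 3 ^ m" "0 \<in> S"
    "\<And>x y. x \<in> S \<Longrightarrow> y \<in> S \<Longrightarrow> x + y \<in> S" "\<And>x y. x \<in> S \<Longrightarrow> y \<in> S \<Longrightarrow> x * y \<in> S"
    "\<And>c x. x \<in> S \<Longrightarrow> to_ac c * x \<in> S"
  proof (cases "m = 0")
    case True
    \<comment> \<open>The equation \<open>x ^ 3 ^ m = x\<close> is void here.\<close>
    then show ?thesis by (intro that[of "{0}"]) auto
  next
    case False
    then have "m > 0" by simp
    note * = subfield_three_pow[OF assms this]
    show ?thesis
      by (rule that[OF *(1)]) (use * *(4)[of 0] in auto)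
  qed
  define sc :: "'f \<Rightarrow> 'f alg_closure \<times> 'f alg_closure \<Rightarrow> _"
    where "sc c p = (to_ac c * fst p, to_ac c * snd p)" for c p
  interpret vector_space sc
    by unfold_locales (auto simp: sc_def algebra_simps)
  have "finite S" using S(1) card.infinite by fastforce
  then have fin: "finite (S \<times> S)" by simp
  have sub: "subspace (S \<times> S)"
    using S by (auto simp: subspace_def sc_def zero_prod_def)
  obtain k E where E: "bij_betw E (coord_space k :: (nat \<Rightarrow> 'f) set) (S \<times> S)" "\<And>u v. E (u + v) = E u + E v"
    by (rule finite_subspace_coord_iso[OF sub fin]) (rule that)
  \<comment> \<open>Comparing cardinalities determines the dimension of K x K.\<close>
  have "card (coord_space k :: (nat \<Rightarrow> 'f) set) = 3 ^ m * 3 ^ m"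
    using bij_betw_same_card[OF E(1)] S(1) by (simp add: card_cartesian_product)
  then have "(3 :: nat) ^ k = 3 ^ (2 * m)"
    by (simp add: card_coord_space assms mult_2 power_add)
  then have "k = 2 * m" by simp
  moreover have "- x \<in> S" if "x \<in> S" for x
    using S(5)[OF that, of "- 1"] by simp
  ultimately show ?thesis
    using S E by (intro that[of S E]) auto
qed

subsection \<open>Sidon sets\<close>

lemma (in vector_space) independent_subset_card_le_dim:
  assumes "T \<subseteq> V" "independent T" "dim V > 0"
  shows "finite T \<and> card T \<le> dim V"
proof -
  obtain B where "V \<subseteq> span B" "card B = dim V" using basis_exists by blast
  \<comment> \<open>An infinite basis would have \<open>card\<close> 0, so positive dimension rules
    it out.\<close>
  moreover from this have "finite B" using assms(3) card_ge_0_finite by metis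
  ultimately show ?thesis using independent_span_bound[of B T] assms by auto
qed

text \<open>Otherwise adding \<open>x\<close> to \<open>T\<close> would give an independent set
  larger than the dimension. It lets points of a flat be written in terms of differences of other
  points of the flat.\<close>

lemma (in vector_space) in_span_if_card_eq_dim:
  assumes "T \<subseteq> V" "independent T" "card T = dim V" "dim V > 0" "x \<in> V"
  shows "x \<in> span T"
proof (rule ccontr)
  assume x: "x \<notin> span T"
  then have "x \<notin> T" using span_base by blast
  moreover have "independent (insert x T)" using x assms independent_insertI by blast
  moreover have "insert x T \<subseteq> V" using assms by blast
  ultimately show False
    using independent_subset_card_le_dim[of "insert x T" V] assms by auto
qed

lemma subspace_coord_space: "coord.subspace (coord_space n)"
  by (auto simp: coord.subspace_def coord_space_def coord_scale_def)

lemma mem_translate_iff: "x \<in> (\<lambda>s. p + s) ` S \<longleftrightarrow> x - p \<in> S" for x p :: "'a::ab_group_add"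
  by (auto simp: image_iff intro: bexI[of _ "x - p"])

lemma flat_span:
  assumes "p \<in> coord_space n" "B \<subseteq> coord_space n" "coord.independent B" "card B = k"
  shows "flat n k ((\<lambda>s. p + s) ` coord.span B)"
  unfolding flat_def using assms
  by (intro exI[of _ p] exI[of _ "coord.span B"])
     (auto simp: coord.dim_eq_card_independent dest: coord.span_minimal[OF _ subspace_coord_space])

text \<open>Geometrically, the line through \<open>a\<close> and \<open>b\<close> has exactly one
  further point \<open>c\<close>, given by \<open>c - a = - (b - a)\<close>, that is, by
  \<open>a + a = b + c\<close>.\<close>

lemma span_singleton_3:
  assumes "CARD('f::field) = 3"
  shows "x \<in> coord.span {u :: nat \<Rightarrow> 'f} \<longleftrightarrow> x = 0 \<or> x = u \<or> x = - u"
proof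
  assume "x \<in> coord.span {u}"
  then obtain c where "x = coord_scale c u" by (auto simp: coord.span_singleton)
  then show "x = 0 \<or> x = u \<or> x = - u" using field_3_cases[OF assms, of c] by auto
qed (auto intro: coord.span_base coord.span_zero coord.span_neg)

section \<open>Sidon sets and the difference bound\<close>

definition sidon :: "'a::ab_group_add set \<Rightarrow> bool" where
  "sidon C \<longleftrightarrow> (\<forall>a\<in>C. \<forall>b\<in>C. \<forall>c\<in>C. \<forall>d\<in>C. a + b = c + d \<longrightarrow> a = c \<or> a = d)"

lemma sidonD: "sidon C \<Longrightarrow> a + b = c + d \<Longrightarrow> a \<in> C \<Longrightarrow> b \<in> C \<Longrightarrow> c \<in> C \<Longrightarrow> d \<in> C \<Longrightarrow> a = c \<or> a = d"
  unfolding sidon_def by blast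

text \<open>Differences of ordered pairs of distinct elements of a Sidon set are nonzero and
  pairwise different. With q + 1 elements there would be (q + 1) q of them, but \<open>V\<close> has
  only q^2 - 1 nonzero elements.\<close>

lemma card_sidon_le:
  assumes "sidon D" "D \<subseteq> V" "finite V" "card V = q * q" "0 \<in> V"
    and diff: "\<And>x y. x \<in> V \<Longrightarrow> y \<in> V \<Longrightarrow> x - y \<in> V"
  shows "card D \<le> q"
proof (rule ccontr)
  assume "\<not> card D \<le> q"
  then have "Suc q \<le> card D" by simp
  then obtain D' where D': "D' \<subseteq> D" "card D' = Suc q" "finite D'"
    using obtain_subset_with_card_n by metis
  let ?P = "SIGMA a:D'. D' - {a}"
  have "inj_on (\<lambda>(a, b). a - b) ?P"
  proof (rule inj_onI)
    fix x y assume "x \<in> ?P" "y \<in> ?P" and eq: "(case x of (a, b) \<Rightarrow> a - b) = (case y of (a, b) \<Rightarrow> a - b)"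
    then obtain a b c d where xy: "x = (a, b)" "y = (c, d)"
      and *: "a \<in> D'" "b \<in> D'" "c \<in> D'" "d \<in> D'" "a \<noteq> b"
      by blast
    \<comment> \<open>Equal differences become equal sums; the alternative \<open>a = b\<close> from
      the Sidon property is excluded by the choice of pairs.\<close>
    then have "a + d = c + b" using eq by (simp add: algebra_simps)
    then have "a = c" using sidonD[OF assms(1), of a d c b] * D' by blast
    then show "x = y" using eq xy by simp
  qed
  moreover have "(\<lambda>(a, b). a - b) ` ?P \<subseteq> V - {0}"
    using D' assms(2) diff by fastforce
  ultimately have "card ?P \<le> card (V - {0})"
    using assms(3) by (meson card_inj_on_le finite_Diff)
  moreover have "card ?P = Suc q * q"
    using D' by (simp add: card_SigmaI)
  moreover have "card (V - {0}) < q * q"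
    using assms(3-5) card_Diff1_less[of V 0] by simp
  ultimately show False by simp
qed

section \<open>2-caps and Sidon sets in characteristic 3\<close>

lemma flat_diffE:
  assumes "flat n k A"
  obtains S where "coord.dim S = k" "\<And>x y. x \<in> A \<Longrightarrow> y \<in> A \<Longrightarrow> x - y \<in> S"
proof -
  from assms obtain p S where "coord.subspace S" "coord.dim S = k" "A = (\<lambda>s. p + s) ` S"
    unfolding flat_def by blast
  then show ?thesis
    by (intro that[of S]) (auto intro: coord.subspace_diff)
qed

lemma two_cap_flatD:
  assumes "two_cap n C" "T \<subseteq> C" "flat n k A" "T \<subseteq> A"
  shows "\<not> (card T = 3 \<and> k = 1)" "\<not> (card T = 4 \<and> k = 2)"
proof -
  have caps: "\<forall>T\<subseteq>C. card T = 3 \<longrightarrow> \<not> (\<exists>A. flat n 1 A \<and> T \<subseteq> A)"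
    "\<forall>T\<subseteq>C. card T = 4 \<longrightarrow> \<not> (\<exists>A. flat n 2 A \<and> T \<subseteq> A)"
    by (rule assms(1)[unfolded two_cap_def, THEN conjunct2, THEN conjunct1],
        rule assms(1)[unfolded two_cap_def, THEN conjunct2, THEN conjunct2])
  show "\<not> (card T = 3 \<and> k = 1)" "\<not> (card T = 4 \<and> k = 2)"
    using caps[rule_format, OF assms(2)] assms(3,4) by auto
qed

text \<open>Characteristic 3 makes an arithmetic progression the same thing as a line, so the
  degenerate Sidon relation \<open>a + a = b + c\<close> accounts for collinear triples.\<close>

lemma two_cap_imp_sidon:
  fixes C :: "(nat \<Rightarrow> 'f::field) set"
  assumes "CARD('f) = 3" and C: "two_cap n C"
  shows "sidon C"
  unfolding sidon_def
proof (intro ballI impI, rule ccontr)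
  note span1 = span_singleton_3[OF assms(1)]
  have sub: "C \<subseteq> coord_space n" using C by (simp add: two_cap_def)
  have diff: "x - y \<in> coord_space n" if "x \<in> C" "y \<in> C" for x y
    using that sub coord.subspace_diff[OF subspace_coord_space] by blast
  have no_line: False if in_C: "a \<in> C" "b \<in> C" "c \<in> C" and ne: "a \<noteq> b" "a \<noteq> c" "b \<noteq> c"
    and eq: "a + a = b + c" for a b c
  proof -
    have flat: "flat n 1 ((\<lambda>s. a + s) ` coord.span {b - a})"
      using in_C ne sub diff by (intro flat_span) auto
    have "c - a = - (b - a)"
      using eq by (simp add: algebra_simps)
    then have "{a, b, c} \<subseteq> (\<lambda>s. a + s) ` coord.span {b - a}"
      by (simp add: mem_translate_iff span1)
    from two_cap_flatD(1)[OF C _ flat this] show False using in_C ne by simp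
  qed
  fix a b c d assume in_C: "a \<in> C" "b \<in> C" "c \<in> C" "d \<in> C"
    and eq: "a + b = c + d" and "\<not> (a = c \<or> a = d)"
  then have ne: "a \<noteq> c" "a \<noteq> d" "b \<noteq> c" "b \<noteq> d"
    by (auto simp: add.commute)
  \<comment> \<open>Doubling is negation in characteristic 3, hence injective.\<close>
  have double: "x = y" if "x + x = y + y" for x y :: "nat \<Rightarrow> 'f"
    using that three_vec_eq_0[OF assms(1), of x] three_vec_eq_0[OF assms(1), of y]
    by (metis add_left_imp_eq add.assoc)
  have "a \<noteq> b"
  proof
    assume "a = b"
    then have *: "a + a = c + d" using eq by simp
    then have "c \<noteq> d" using double[of a c] ne by blast
    from no_line[OF in_C(1,3,4) ne(1,2) this *] show False .
  qed
  have "c \<noteq> d"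
  proof
    assume "c = d"
    then have "c + c = a + b" using eq by simp
    from no_line[OF in_C(3,1,2) ne(1)[symmetric] ne(3)[symmetric] \<open>a \<noteq> b\<close> this] show False .
  qed
  \<comment> \<open>Noncollinearity of \<open>a\<close>, \<open>b\<close>, \<open>c\<close> makes
    the flat spanned at \<open>a\<close> two-dimensional. The relation \<open>a + b = c + d\<close>
    then puts the fourth vertex \<open>d\<close> of the parallelogram into it.\<close>
  have "b - a \<notin> coord.span {c - a}"
  proof
    assume "b - a \<in> coord.span {c - a}"
    then have "b - a = - (c - a)"
      using \<open>a \<noteq> b\<close> ne by (auto simp: span1)
    then have "a + a = b + c"
      by (simp add: algebra_simps)
    from no_line[OF in_C(1-3) \<open>a \<noteq> b\<close> ne(1) ne(3) this] show False .
  qed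
  then have "coord.independent {b - a, c - a}" "b - a \<noteq> c - a"
    using ne by (auto simp: coord.independent_insert)
  then have flat: "flat n 2 ((\<lambda>s. a + s) ` coord.span {b - a, c - a})" (is "flat n 2 ?A")
    using in_C ne sub diff by (intro flat_span) auto
  have "{a, b, c, d} \<subseteq> ?A"
  proof -
    have "d - a = (b - a) - (c - a)"
      using eq by (simp add: algebra_simps)
    then have "d - a \<in> coord.span {b - a, c - a}"
      using coord.span_diff[of "b - a" "{b - a, c - a}" "c - a"] by (simp add: coord.span_base)
    then show ?thesis
      by (simp add: mem_translate_iff coord.span_base coord.span_zero)
  qed
  from two_cap_flatD(2)[OF C _ flat this] show False
    using in_C ne \<open>a \<noteq> b\<close> \<open>c \<noteq> d\<close> by simp
qed

text \<open>Three collinear points form an arithmetic progression. For four coplanar points, three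
  of them give an origin and a basis of the plane, whose nine points are then checked as positions
  of the fourth: each one is a coincidence or a forbidden sum relation.\<close>

lemma sidon_imp_two_cap:
  fixes C :: "(nat \<Rightarrow> 'f::field) set"
  assumes "CARD('f) = 3" "C \<subseteq> coord_space n" and sidon: "sidon C"
  shows "two_cap n C"
proof -
  note span1 = span_singleton_3[OF assms(1)]
  have not_span: "c - a \<notin> coord.span {b - a}"
    if "a \<in> C" "b \<in> C" "c \<in> C" "a \<noteq> b" "a \<noteq> c" "b \<noteq> c" for a b c
  proof
    assume "c - a \<in> coord.span {b - a}"
    then have "c - a = - (b - a)" using that by (auto simp: span1)
    then have "a + a = b + c" by (simp add: algebra_simps)
    then show False using sidonD[OF sidon, of a a b c] that by blast
  qed
  have indep1: "coord.independent {b - a}" if "a \<noteq> b" for a b :: "nat \<Rightarrow> 'f"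
    using that by simp
  have line: False if T: "T \<subseteq> C" "card T = 3" and A: "flat n 1 A" "T \<subseteq> A" for T A
  proof -
    obtain a b c where abc: "T = {a, b, c}" "a \<noteq> b" "a \<noteq> c" "b \<noteq> c"
      using T(2) by (auto simp: card_3_iff)
    obtain S where S: "coord.dim S = 1" "\<And>x y. x \<in> A \<Longrightarrow> y \<in> A \<Longrightarrow> x - y \<in> S"
      using flat_diffE[OF A(1)] by blast
    have "c - a \<in> coord.span {b - a}"
      using abc A S by (intro coord.in_span_if_card_eq_dim[of _ S] indep1) auto
    then show False using not_span[of a b c] abc T(1) by auto
  qed
  have plane: False if T: "T \<subseteq> C" "card T = 4" and A: "flat n 2 A" "T \<subseteq> A" for T A
  proof -
    obtain d Y where Y: "T = insert d Y" "d \<notin> Y" "card Y = 3"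
      using T(2) card_Suc_eq[of T 3] by auto
    then obtain a b c where abc: "Y = {a, b, c}" "a \<noteq> b" "a \<noteq> c" "b \<noteq> c"
      by (auto simp: card_3_iff)
    obtain S where S: "coord.dim S = 2" "\<And>x y. x \<in> A \<Longrightarrow> y \<in> A \<Longrightarrow> x - y \<in> S"
      using flat_diffE[OF A(1)] by blast
    have in_C: "a \<in> C" "b \<in> C" "c \<in> C" "d \<in> C" using T Y abc by auto
    have ne: "d \<noteq> a" "d \<noteq> b" "d \<noteq> c" using Y abc by auto
    have "c - a \<notin> coord.span {b - a}" using not_span abc in_C by blast
    then have "coord.independent {c - a, b - a}" "c - a \<noteq> b - a"
      using abc by (auto simp: coord.independent_insert)
    then have "d - a \<in> coord.span {c - a, b - a}"
      using abc Y A S by (intro coord.in_span_if_card_eq_dim[of _ S]) auto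
    \<comment> \<open>Both coordinates of \<open>d - a\<close> in the basis \<open>c - a\<close>,
      \<open>b - a\<close> lie in {0, 1, -1}; \<open>w\<close> below is the component along
      \<open>c - a\<close>.\<close>
    then obtain t where "d - a - coord_scale t (c - a) \<in> coord.span {b - a}"
      unfolding coord.span_breakdown_eq by blast
    moreover have "coord_scale t (c - a) = 0 \<or> coord_scale t (c - a) = c - a \<or> coord_scale t (c - a) = - (c - a)"
      using field_3_cases[OF assms(1), of t] by auto
    ultimately obtain w where "w = 0 \<or> w = c - a \<or> w = - (c - a)"
      "d - a - w = 0 \<or> d - a - w = b - a \<or> d - a - w = - (b - a)"
      unfolding span1 by metis
    then consider "d = a" | "d = b" | "a + a = d + b" | "d = c" | "d + a = b + c" | "d + b = a + c"
      | "a + a = d + c" | "d + c = a + b" | "d + b + c = a + a + a"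
      by (elim disjE) (simp_all add: algebra_simps)
    then show False
    proof cases
      case 3
      from sidonD[OF sidon 3 in_C(1,1,4,2)] show ?thesis using ne abc by simp
    next
      case 5
      from sidonD[OF sidon 5 in_C(4,1,2,3)] show ?thesis using ne by simp
    next
      case 6
      from sidonD[OF sidon 6 in_C(4,2,1,3)] show ?thesis using ne by simp
    next
      case 7
      from sidonD[OF sidon 7 in_C(1,1,4,3)] show ?thesis using ne abc by simp
    next
      case 8
      from sidonD[OF sidon 8 in_C(4,3,1,2)] show ?thesis using ne by simp
    next
      case 9
      \<comment> \<open>Triples of equal summands vanish, so
        \<open>d + b + c = 0 = c + c + c\<close>; thus \<open>b\<close>, \<open>c\<close>,
        \<open>d\<close> are collinear.\<close>
      then have "d + b = c + c"
        using three_vec_eq_0[OF assms(1), of a] three_vec_eq_0[OF assms(1), of c]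
        by (metis add_right_cancel)
      from sidonD[OF sidon this in_C(4,2,3,3)] show ?thesis using ne by simp
    qed (use ne in simp_all)
  qed
  show ?thesis
    unfolding two_cap_def
  proof (intro conjI allI impI notI)
    show "C \<subseteq> coord_space n" by (rule assms(2))
  qed (elim exE conjE, rule line plane; assumption)+
qed

lemma two_cap_iff_sidon:
  fixes C :: "(nat \<Rightarrow> 'f::field) set"
  assumes "CARD('f) = 3"
  shows "two_cap n C \<longleftrightarrow> C \<subseteq> coord_space n \<and> sidon C"
proof (intro iffI conjI)
  show "C \<subseteq> coord_space n" if "two_cap n C" using that by (simp add: two_cap_def)
qed (simp_all add: two_cap_imp_sidon sidon_imp_two_cap assms)

section \<open>The partition into parabolas\<close>

theorem theorem3p6:
  fixes n :: nat
  assumes "CARD('f::field) = 3"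
    and "even n"
  shows "\<exists>P :: (nat \<Rightarrow> 'f) set set.
    partition_on (coord_space n) P \<and> (\<forall>C\<in>P. maximal_two_cap n C)"
proof -
  obtain m where n: "n = 2 * m" using assms(2) by (elim evenE)
  obtain S :: "'f alg_closure set" and E :: "(nat \<Rightarrow> 'f) \<Rightarrow> 'f alg_closure \<times> 'f alg_closure"
    where S: "card S = 3 ^ m" "\<And>x y. x \<in> S \<Longrightarrow> y \<in> S \<Longrightarrow> x + y \<in> S"
      "\<And>x y. x \<in> S \<Longrightarrow> y \<in> S \<Longrightarrow> x * y \<in> S" "\<And>x. x \<in> S \<Longrightarrow> - x \<in> S"
    and bij: "bij_betw E (coord_space n) (S \<times> S)" and add: "\<And>u v. E (u + v) = E u + E v"
    by (rule two_coordinates_over_subfield[OF assms(1), where m = m, folded n]) (rule that)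
  have diff: "x - y \<in> S" if "x \<in> S" "y \<in> S" for x y
    using S(2)[OF that(1) S(4)[OF that(2)]] by simp
  \<comment> \<open>The level sets of y - x^2 are the parabolas, so \<open>C k\<close> is the
    preimage of y = x^2 + k under \<open>E\<close>.\<close>
  define h where "h v = snd (E v) - fst (E v) * fst (E v)" for v
  define C where "C k = {v \<in> coord_space n. h v = k}" for k
  have E_in: "fst (E v) \<in> S" "snd (E v) \<in> S" if "v \<in> coord_space n" for v
    using bij_betwE[OF bij] that by (auto simp: mem_Times_iff)
  have card_C: "card (C k) = 3 ^ m" if "k \<in> S" for k
  proof -
    \<comment> \<open>A parabola is the graph of a function of its first coordinate.\<close>
    have "bij_betw (\<lambda>v. fst (E v)) (C k) S"
      unfolding bij_betw_def
    proof (intro conjI equalityI subsetI)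
      show "inj_on (\<lambda>v. fst (E v)) (C k)"
        using bij by (auto simp: inj_on_def bij_betw_def C_def h_def prod_eq_iff algebra_simps)
    next
      fix x assume "x \<in> S"
      then have "(x, x * x + k) \<in> E ` coord_space n"
        using S that bij by (auto simp: bij_betw_def)
      then obtain v where "v \<in> coord_space n" "E v = (x, x * x + k)" by auto
      then show "x \<in> (\<lambda>v. fst (E v)) ` C k"
        by (intro image_eqI[of _ _ v]) (auto simp: C_def h_def)
    qed (use E_in in \<open>auto simp: C_def\<close>)
    then show ?thesis using S(1) bij_betw_same_card by metis
  qed
  have sidon: "sidon (C k)" for k
    unfolding sidon_def
  proof (intro ballI impI)
    fix a b c d assume "a \<in> C k" "b \<in> C k" "c \<in> C k" "d \<in> C k" and eq: "a + b = c + d"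
    then have in_n: "a \<in> coord_space n" "c \<in> coord_space n" "d \<in> coord_space n"
      and snd: "snd (E a) = fst (E a) * fst (E a) + k" "snd (E b) = fst (E b) * fst (E b) + k"
        "snd (E c) = fst (E c) * fst (E c) + k" "snd (E d) = fst (E d) * fst (E d) + k"
      by (auto simp: C_def h_def algebra_simps)
    define x y z w where "x = fst (E a)" "y = fst (E b)" "z = fst (E c)" "w = fst (E d)"
    have E_eq: "E a + E b = E c + E d" using eq add by metis
    then have y: "y = z + w - x"
      unfolding x_y_z_w_def by (simp add: prod_eq_iff algebra_simps)
    have sq: "x * x + y * y = z * z + w * w"
      using arg_cong[OF E_eq, of snd] snd unfolding x_y_z_w_def by (simp add: algebra_simps)
    \<comment> \<open>Substituting y = z + w - x into the equation of squares leaves this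
      product.\<close>
    have "(1 + 1) * ((x - z) * (x - w)) = 0"
      using sq unfolding y by (simp add: algebra_simps)
    moreover have "(1 + 1 :: 'f alg_closure) \<noteq> 0"
    proof
      assume "(1 + 1 :: 'f alg_closure) = 0"
      then have "of_nat 2 = (0 :: 'f alg_closure)" by simp
      then show False
        unfolding of_nat_eq_0_iff_char_dvd using CHAR_eq_3[OF assms(1)] by simp
    qed
    ultimately have "x = z \<or> x = w" by simp
    \<comment> \<open>On a parabola the first coordinate determines the second, and \<open>E\<close>
      is injective.\<close>
    then have "E a = E c \<or> E a = E d"
      using snd unfolding x_y_z_w_def by (auto simp: prod_eq_iff)
    then show "a = c \<or> a = d"
      using bij in_n by (auto simp: bij_betw_def inj_on_def)
  qed
  have card_n: "card (coord_space n :: (nat \<Rightarrow> 'f) set) = 3 ^ m * 3 ^ m"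
    by (simp add: card_coord_space assms n mult_2 power_add)
  then have fin: "finite (coord_space n :: (nat \<Rightarrow> 'f) set)"
    by (intro card_ge_0_finite) simp
  \<comment> \<open>The difference bound with q = 3^m is attained by every \<open>C k\<close> with
    \<open>k\<close> in \<open>S\<close>, which makes these caps maximal.\<close>
  have bound: "card D \<le> 3 ^ m" if "two_cap n D" for D :: "(nat \<Rightarrow> 'f) set"
    using that fin card_n coord.subspace_diff[OF subspace_coord_space]
      coord.subspace_0[OF subspace_coord_space]
    unfolding two_cap_iff_sidon[OF assms(1)] by (intro card_sidon_le) auto
  have "maximal_two_cap n (C k)" if "k \<in> S" for k
    unfolding maximal_two_cap_def
    using bound card_C[OF that] sidon[of k] two_cap_iff_sidon[OF assms(1), of n "C k"]
    by (auto simp: C_def)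
  moreover have "partition_on (coord_space n) (C ` S)"
  proof (rule partition_onI)
    show "\<Union> (C ` S) = coord_space n"
      \<comment> \<open>Closure of \<open>S\<close> under products and differences puts
        \<open>h v\<close> into \<open>S\<close>, so every point lies on one of the chosen
        parabolas.\<close>
      using E_in S diff by (auto simp: C_def h_def)
    show "disjnt p q" if "p \<in> C ` S" "q \<in> C ` S" "p \<noteq> q" for p q
      using that by (auto simp: C_def disjnt_def)
    show "{} \<notin> C ` S"
      using card_C by (metis card.empty imageE power_not_zero zero_neq_numeral)
  qed
  ultimately show ?thesis by blast
qed

end
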